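(* Let $H:=g+\widetilde\varphi$ and suppose that $\nabla H$ is Lipschitz continuous with constant $\beta>0$ and that $H$ is bounded below, with $H^*:=\inf H$. Fix a constant $c>0$ and a starting point $u_1\in\mathbb{R}^d$, and let $(u_k)_{k\ge1}$ be generated by the inexact gradient descent method $$u_{k+1}=u_k-\frac{1}{\beta}v_k,\qquad k\ge 1,$$ where the vectors $v_k\in\mathbb{R}^d$ satisfy $\|v_k-\nabla H(u_k)\|\le \frac{c}{k}$ for every $k\ge1$. Then for every $k\ge 1$, $$\min_{i=1,\ldots,k}\|\nabla H(u_i)\|^2\le \frac1k\sum_{i=1}^k\|\nabla H(u_i)\|^2\le \frac{2\beta\,(H(u_1)-H^* )}{k}+\frac1k\sum_{i=1}^k\|v_i-\nabla H(u_i)\|^2\le\frac{2\beta\,(H(u_1)-H^* )}{k}+\frac{c^2\pi^2}{6k}.$$ Moreover, if $u^*$ is a minimizer of $H$, the right-hand side is at most $$\frac{\beta^2\|u_1-u^*\|^2+c^2\pi^2/6}{k}.$$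
   Context: Let $n,d\ge 1$, let $q\in\mathbb{R}^n$ be fixed, let $f\colon\mathbb{R}^n\to\mathbb{R}$ be convex and $C^2$-smooth, let $A\colon\mathbb{R}^d\to\mathbb{R}^{n\times n}$ be $C^2$-smooth with $A(u)$ invertible for every $u\in\mathbb{R}^d$, and let $g\colon\mathbb{R}^d\to\mathbb{R}$ be smooth. Fix $\lambda>0$. The reduced function is $$\widetilde\varphi(u)=\min_{y\in\mathbb{R}^n}\Big\{f(y)+\frac{\lambda}{2}\|A(u)y-q\|^2\Big\},\qquad u\in\mathbb{R}^d;$$ the minimum is attained at a unique point and $\widetilde\varphi$ is differentiable. Norms are Euclidean. *)

theory Defs
  imports "HOL-Analysis.Analysis"
begin

(* C^k on the whole space. Recursing on the directional derivatives keeps the type of f fixed;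
   on a finite-dimensional domain, continuity of x |-> Df(x) v for every v is
   continuity of Df in operator norm, so this is the usual notion there. *)
primrec C_k :: "nat \<Rightarrow> ('a::real_normed_vector \<Rightarrow> 'b::real_normed_vector) \<Rightarrow> bool" where
  "C_k 0 f \<longleftrightarrow> continuous_on UNIV f"
| "C_k (Suc k) f \<longleftrightarrow>
     (\<forall>x. f differentiable (at x)) \<and> (\<forall>v. C_k k (\<lambda>x. frechet_derivative f (at x) v))"

(* Arbitrary value where F is not differentiable. *)
definition gradient :: "('a::real_inner \<Rightarrow> real) \<Rightarrow> 'a \<Rightarrow> 'a" where
  "gradient F x = (THE D. GDERIV F x :> D)"

definition objective ::
  "(real^'n \<Rightarrow> real) \<Rightarrow> (real^'d \<Rightarrow> real^'n^'n) \<Rightarrow> real^'n \<Rightarrow> real \<Rightarrow> real^'d \<Rightarrow> real^'n \<Rightarrow> real" where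
  "objective f A q lam u y = f y + lam / 2 * (norm (A u *v y - q))\<^sup>2"

(* LEAST over the range is the minimum value, not merely the infimum;
   it is arbitrary when the minimum is not attained. *)
definition reduced_fun ::
  "(real^'n \<Rightarrow> real) \<Rightarrow> (real^'d \<Rightarrow> real^'n^'n) \<Rightarrow> real^'n \<Rightarrow> real \<Rightarrow> real^'d \<Rightarrow> real" where
  "reduced_fun f A q lam u = (LEAST t. t \<in> range (objective f A q lam u))"

end

theory Submission
  imports Defs
begin

text \<open>
  Pointwise minimality of \<open>y(u)\<close> sandwiches \<open>\<phi>(u) - \<phi>(u\<^sub>0)\<close>, where \<open>\<phi>\<close> is the reduced function,
  between the increments of the objective in \<open>u\<close> at \<open>y(u)\<close> and at \<open>y(u\<^sub>0)\<close>. Strong convexity of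
  the objective in \<open>y\<close> makes the minimizer continuous in \<open>u\<close>, so both increments have the same
  linearization and \<open>\<phi>\<close> is differentiable (no implicit function theorem is needed). With
  \<open>G = \<nabla>H(u\<^sub>i)\<close>, the descent lemma along \<open>u\<^sub>i\<^sub>+\<^sub>1 = u\<^sub>i - v\<^sub>i/\<beta>\<close> then gives
  \<open>\<parallel>G\<parallel>\<^sup>2 \<le> 2\<beta>(H(u\<^sub>i) - H(u\<^sub>i\<^sub>+\<^sub>1)) + \<parallel>v\<^sub>i - G\<parallel>\<^sup>2\<close>, which telescopes; the errors are summed by
  \<open>\<Sum> 1/i\<^sup>2 = \<pi>\<^sup>2/6\<close>.
\<close>

section \<open>Gradients\<close>

text \<open>Ensures that the definite description in \<open>gradient\<close> is meaningful wherever
  a gradient exists.\<close>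

lemma GDERIV_unique:
  assumes "GDERIV F x :> D" "GDERIV F x :> D'"
  shows "D = D'"
proof -
  have "(\<lambda>h. h \<bullet> D) = (\<lambda>h. h \<bullet> D')"
    using assms unfolding gderiv_def by (rule has_derivative_unique)
  then have "\<forall>h. h \<bullet> D = h \<bullet> D'"
    by metis
  then show ?thesis
    by (simp only: vector_eq_ldot)
qed

lemma gradient_eqI: "GDERIV F x :> D \<Longrightarrow> gradient F x = D"
  unfolding gradient_def by (blast intro: the_equality GDERIV_unique)

text \<open>Riesz representation in finite dimension: pairing \<open>h\<close> with
  \<open>adjoint L 1\<close> returns \<open>L h\<close>, so this vector represents the
  derivative.\<close>

lemma GDERIV_gradient:
  fixes F :: "'a::euclidean_space \<Rightarrow> real"
  assumes "F differentiable (at x)"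
  shows "GDERIV F x :> gradient F x"
proof -
  obtain L where L: "(F has_derivative L) (at x)"
    using assms unfolding differentiable_def by blast
  then have "linear L"
    by (rule has_derivative_linear)
  then have "L h = h \<bullet> adjoint L 1" for h
    using adjoint_works[of L h "1::real"] by (simp add: inner_commute)
  then have "L = (\<lambda>h. h \<bullet> adjoint L 1)"
    by blast
  with L have "GDERIV F x :> adjoint L 1"
    unfolding gderiv_def by metis
  then show ?thesis
    using gradient_eqI by metis
qed

lemma gradient_zero_at_min:
  fixes F :: "'a::euclidean_space \<Rightarrow> real"
  assumes "F differentiable (at x)" and "\<And>y. F x \<le> F y"
  shows "gradient F x = 0"
proof -
  have "(F has_derivative (\<lambda>h. h \<bullet> gradient F x)) (at x)"
    using GDERIV_gradient[OF assms(1)] by (simp add: gderiv_def)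
  then have "(\<lambda>h. h \<bullet> gradient F x) = (\<lambda>h. 0)"
    by (rule differential_zero_maxmin[where S=UNIV, rotated 2]) (use assms(2) in auto)
  then show ?thesis
    by (metis inner_eq_zero_iff)
qed

text \<open>Along the segment from \<open>x\<close> to \<open>y\<close>, \<open>p\<close> is
  \<open>F\<close> minus the non-constant part of its quadratic upper model. The Lipschitz bound
  makes its derivative nonpositive, so comparing \<open>p 1\<close> with \<open>p 0\<close> replaces
  integrating the gradient.\<close>

lemma descent_lemma:
  fixes F :: "'a::euclidean_space \<Rightarrow> real"
  assumes diff: "\<And>x. F differentiable (at x)"
    and lip: "\<beta>-lipschitz_on UNIV (gradient F)"
  shows "F y \<le> F x + gradient F x \<bullet> (y - x) + \<beta> / 2 * (norm (y - x))\<^sup>2"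
proof -
  define d where "d = y - x"
  define p where "p = (\<lambda>t. F (x + t *\<^sub>R d) - t * (gradient F x \<bullet> d) - \<beta> * t\<^sup>2 / 2 * (norm d)\<^sup>2)"
  have der: "(p has_real_derivative
      (d \<bullet> gradient F (x + t *\<^sub>R d) - gradient F x \<bullet> d - \<beta> * t * (norm d)\<^sup>2)) (at t)" for t
  proof -
    have "(F has_derivative (\<lambda>h. h \<bullet> gradient F (x + t *\<^sub>R d))) (at (x + t *\<^sub>R d))"
      using GDERIV_gradient[OF diff] by (simp add: gderiv_def)
    moreover have "((\<lambda>t. x + t *\<^sub>R d) has_derivative (\<lambda>s. s *\<^sub>R d)) (at t)"
      by (auto intro!: derivative_eq_intros)
    ultimately have "((\<lambda>t. F (x + t *\<^sub>R d)) has_derivative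
        (\<lambda>s. (s *\<^sub>R d) \<bullet> gradient F (x + t *\<^sub>R d))) (at t)"
      by (rule has_derivative_compose[rotated])
    then have "((\<lambda>t. F (x + t *\<^sub>R d)) has_real_derivative (d \<bullet> gradient F (x + t *\<^sub>R d))) (at t)"
      by (simp add: has_field_derivative_def mult.commute[of _ "d \<bullet> _"])
    then show ?thesis
      unfolding p_def by (auto intro!: derivative_eq_intros)
  qed
  have "p 1 \<le> p 0"
  proof (rule DERIV_nonpos_imp_nonincreasing[of 0 1 p])
    fix t :: real
    assume t: "0 \<le> t" "t \<le> 1"
    have "d \<bullet> gradient F (x + t *\<^sub>R d) - gradient F x \<bullet> d = d \<bullet> (gradient F (x + t *\<^sub>R d) - gradient F x)"
      by (simp add: inner_diff_right inner_commute)
    also have "\<dots> \<le> norm d * norm (gradient F (x + t *\<^sub>R d) - gradient F x)"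
      by (rule norm_cauchy_schwarz)
    also have "\<dots> \<le> norm d * (\<beta> * norm (t *\<^sub>R d))"
      using lipschitz_onD[OF lip, of "x + t *\<^sub>R d" x]
      by (intro mult_left_mono) (auto simp: dist_norm)
    also have "\<dots> = \<beta> * t * (norm d)\<^sup>2"
      using t by (simp add: power2_eq_square)
    finally show "\<exists>z. (p has_real_derivative z) (at t) \<and> z \<le> 0"
      using der[of t] by (intro exI conjI) auto
  qed simp
  then show ?thesis
    by (simp add: p_def d_def)
qed

section \<open>Differentiability of the reduced function\<close>

text \<open>Cauchy-Schwarz in each row; \<open>norm M\<close> is the Frobenius norm, the Euclidean
  norm of the row norms.\<close>

lemma norm_matrix_vector_mult_le:
  fixes M :: "real^'n^'m"
  shows "norm (M *v x) \<le> norm M * norm x"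
proof -
  have "\<bar>(M *v x) $ i\<bar> \<le> norm (M $ i) * norm x" for i
    using Cauchy_Schwarz_ineq2[of "M $ i" x] by (simp add: matrix_vector_mul_component)
  then have "norm (M *v x) \<le> L2_set (\<lambda>i. norm (M $ i) * norm x) UNIV"
    unfolding norm_vec_def by (intro L2_set_mono) auto
  then show ?thesis
    by (simp add: L2_set_left_distrib norm_vec_def)
qed

lemma bounded_bilinear_matrix_vector_mult:
  "bounded_bilinear ((*v) :: real^'n^'m \<Rightarrow> real^'n \<Rightarrow> real^'m)"
proof
  show "\<exists>K. \<forall>(M::real^'n^'m) x. norm (M *v x) \<le> norm M * norm x * K"
    using norm_matrix_vector_mult_le by (intro exI[of _ 1]) auto
qed (auto simp: matrix_vector_mult_add_rdistrib matrix_vector_right_distrib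
      scaleR_matrix_vector_assoc matrix_vector_mult_scaleR)

text \<open>A product rule that asks only continuity of \<open>w\<close>: the term that would
  differentiate \<open>w\<close> carries the factor \<open>d x = 0\<close>. This suits the
  minimizer, which is shown to be continuous in the parameter but not differentiable.\<close>

lemma (in bounded_bilinear) has_derivative_vanishing_left:
  fixes d :: "'d::real_normed_vector \<Rightarrow> 'a" and w :: "'d \<Rightarrow> 'b"
  assumes d: "(d has_derivative d') (at x)" and dx: "d x = 0"
    and w: "(w \<longlongrightarrow> w x) (at x)"
  shows "((\<lambda>y. prod (d y) (w y)) has_derivative (\<lambda>h. prod (d' h) (w x))) (at x)"
proof -
  have d': "bounded_linear d'"
    using d by (rule has_derivative_bounded_linear)
  obtain K where K: "K \<ge> 0" "\<And>a b. norm (prod a b) \<le> norm a * norm b * K"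
    using nonneg_bounded by blast
  obtain C where C: "\<And>h. norm (d' h) \<le> norm h * C"
    using bounded_linear.bounded[OF d'] by blast
  define R where "R y = (1 / norm (y - x)) *\<^sub>R (d y - d' (y - x))" for y
  have R: "(R \<longlongrightarrow> 0) (at x)"
    using d dx unfolding has_derivative_at2 R_def by simp
  have w0: "((\<lambda>y. norm (w y - w x)) \<longlongrightarrow> 0) (at x)"
    using w by (simp add: LIM_zero tendsto_norm_zero)
  \<comment> \<open>The error divided by \<open>norm (y - x)\<close> is
    \<open>prod (R y) (w y)\<close> plus the term treated here, in which the difference quotient of
    \<open>d'\<close> stays bounded by \<open>C\<close> while \<open>w y - w x\<close>
    vanishes.\<close>
  have "((\<lambda>y. prod ((1 / norm (y - x)) *\<^sub>R d' (y - x)) (w y - w x)) \<longlongrightarrow> 0) (at x)"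
  proof (rule Lim_null_comparison)
    show "((\<lambda>y. C * norm (w y - w x) * K) \<longlongrightarrow> 0) (at x)"
      using tendsto_mult[OF tendsto_mult[OF tendsto_const w0] tendsto_const, of C K] by simp
    show "\<forall>\<^sub>F y in at x. norm (prod ((1 / norm (y - x)) *\<^sub>R d' (y - x)) (w y - w x))
        \<le> C * norm (w y - w x) * K"
    proof (rule eventually_at_topological[THEN iffD2], intro exI[of _ UNIV] conjI ballI impI)
      fix y assume "y \<noteq> x"
      then have "norm ((1 / norm (y - x)) *\<^sub>R d' (y - x)) \<le> C"
        using C[of "y - x"] by (simp add: field_simps)
      then show "norm (prod ((1 / norm (y - x)) *\<^sub>R d' (y - x)) (w y - w x))
          \<le> C * norm (w y - w x) * K"
        by (intro order.trans[OF K(2)] mult_right_mono K(1)) auto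
    qed auto
  qed
  moreover have "((\<lambda>y. prod (R y) (w y)) \<longlongrightarrow> 0) (at x)"
    using tendsto[OF R w] by (simp add: zero_left)
  ultimately have "((\<lambda>y. prod (R y) (w y)
      + prod ((1 / norm (y - x)) *\<^sub>R d' (y - x)) (w y - w x)) \<longlongrightarrow> 0) (at x)"
    using tendsto_add by fastforce
  then have "((\<lambda>y. (1 / norm (y - x)) *\<^sub>R
      (prod (d y) (w y) - (prod (d x) (w x) + prod (d' (y - x)) (w x)))) \<longlongrightarrow> 0) (at x)"
    by (simp add: R_def dx zero_left scaleR_left scaleR_right diff_left diff_right algebra_simps)
  then show ?thesis
    unfolding has_derivative_at2
    using bounded_linear_compose[OF bounded_linear_left d'] by blast
qed

text \<open>Since \<open>P\<close> and \<open>Q\<close> touch \<open>F\<close> at \<open>x\<close>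
  and share \<open>L\<close>, the remainder quotients of \<open>F\<close> lie between theirs, which
  tend to 0.\<close>

lemma has_derivative_sandwich:
  fixes P Q F :: "'a::real_normed_vector \<Rightarrow> real"
  assumes P: "(P has_derivative L) (at x)" and Q: "(Q has_derivative L) (at x)"
    and eq: "P x = F x" "Q x = F x" and le: "\<And>y. Q y \<le> F y" "\<And>y. F y \<le> P y"
  shows "(F has_derivative L) (at x)"
  unfolding has_derivative_at2
proof
  show "bounded_linear L"
    using P by (rule has_derivative_bounded_linear)
  show "((\<lambda>y. (1 / norm (y - x)) *\<^sub>R (F y - (F x + L (y - x)))) \<longlongrightarrow> 0) (at x)"
  proof (rule real_tendsto_sandwich)
    show "((\<lambda>y. (1 / norm (y - x)) *\<^sub>R (Q y - (Q x + L (y - x)))) \<longlongrightarrow> 0) (at x)"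
      using Q unfolding has_derivative_at2 by blast
    show "((\<lambda>y. (1 / norm (y - x)) *\<^sub>R (P y - (P x + L (y - x)))) \<longlongrightarrow> 0) (at x)"
      using P unfolding has_derivative_at2 by blast
  qed (use eq le in \<open>auto intro!: always_eventually mult_left_mono divide_right_mono\<close>)
qed

section \<open>Existence of minimizers in \<open>y\<close>\<close>

lemma convex_on_ge_affine_in_norm:
  fixes f :: "'a::euclidean_space \<Rightarrow> real"
  assumes "convex_on UNIV f"
  obtains K where "K \<ge> 0" "\<And>y. norm y \<ge> 1 \<Longrightarrow> f y \<ge> f 0 - K * norm y"
proof -
  have "continuous_on (cball 0 1) f"
    using convex_on_continuous[OF open_UNIV assms] continuous_on_subset by blast
  then obtain m where m: "\<And>y. y \<in> cball 0 1 \<Longrightarrow> f m \<le> f y"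
    using continuous_attains_inf[of "cball (0::'a) 1" f] by fastforce
  have "f y \<ge> f 0 - (f 0 - f m) * norm y" if y: "norm y \<ge> 1" for y
  proof -
    \<comment> \<open>This \<open>t\<close> puts \<open>t *\<^sub>R y\<close> on the unit sphere,
      where \<open>f\<close> is at least \<open>f m\<close>. Convexity between 0 and
      \<open>y\<close> then lets \<open>f\<close> fall at most linearly in
      \<open>norm y\<close>.\<close>
    define t where "t = 1 / norm y"
    have t: "0 < t" "t \<le> 1"
      using y by (auto simp: t_def divide_simps)
    have "f m \<le> f ((1 - t) *\<^sub>R 0 + t *\<^sub>R y)"
      using y by (intro m) (auto simp: t_def)
    also have "\<dots> \<le> (1 - t) * f 0 + t * f y"
      using t by (intro convex_onD[OF assms]) auto
    finally have "f m * norm y \<le> ((1 - t) * f 0 + t * f y) * norm y"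
      by (rule mult_right_mono) simp
    also have "\<dots> = norm y * f 0 - f 0 + f y"
      using y by (simp add: t_def field_simps)
    finally show ?thesis
      by (simp add: algebra_simps)
  qed
  moreover have "f 0 - f m \<ge> 0"
    using m[of 0] by simp
  ultimately show thesis
    using that by blast
qed

lemma invertible_bounded_below:
  fixes M :: "real^'n^'n"
  assumes "invertible M"
  obtains s where "s > 0" "\<And>x. norm (M *v x) \<ge> s * norm x"
proof -
  have "inj ((*v) M)"
    using assms by (rule inj_matrix_vector_mult)
  then obtain s where "s > 0" "\<And>x. s * norm x \<le> norm (M *v x)"
    using linear_inj_bounded_below_pos[OF matrix_vector_mul_linear] by metis
  then show thesis
    using that by blast
qed

text \<open>Coercivity: \<open>A u\<close> is bounded below, so the quadratic term outgrows the at
  most linear decrease of \<open>f\<close>. Outside a ball the objective is at least its value at 0;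
  inside, compactness applies.\<close>

lemma objective_attains_min:
  assumes f: "convex_on UNIV f" and lam: "lam > 0" and inv: "invertible (A u)"
  shows "\<exists>y. \<forall>z. objective f A q lam u y \<le> objective f A q lam u z"
proof -
  let ?\<Phi> = "objective f A q lam u"
  obtain K where K: "K \<ge> 0" "\<And>y. norm y \<ge> 1 \<Longrightarrow> f y \<ge> f 0 - K * norm y"
    using convex_on_ge_affine_in_norm[OF f] by blast
  obtain s where s: "s > 0" "\<And>x. norm (A u *v x) \<ge> s * norm x"
    using invertible_bounded_below[OF inv] by blast
  \<comment> \<open>The coefficient of \<open>(norm y)\<^sup>2\<close> that survives splitting
    \<open>A u *v y\<close> into \<open>A u *v y - q\<close> and \<open>q\<close> by
    \<open>(a + b)\<^sup>2 \<le> 2 * a\<^sup>2 + 2 * b\<^sup>2\<close>.\<close>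
  define a where "a = lam * s\<^sup>2 / 4"
  have a: "a > 0"
    using s lam by (simp add: a_def)
  \<comment> \<open>Beyond \<open>R\<close>, \<open>a * norm y - K\<close> is at least
    \<open>lam * (norm q)\<^sup>2\<close>: one half pays for the value at 0, the other for the loss
    in the splitting. The bound 1 makes the linear estimate on \<open>f\<close> available.\<close>
  define R where "R = max 1 ((K + lam * (norm q)\<^sup>2) / a)"
  have far: "?\<Phi> 0 \<le> ?\<Phi> y" if y: "norm y \<ge> R" for y
  proof -
    have y1: "norm y \<ge> 1" and "(K + lam * (norm q)\<^sup>2) / a \<le> norm y"
      using y by (auto simp: R_def)
    then have ar: "lam * (norm q)\<^sup>2 \<le> a * norm y - K"
      using a by (simp add: field_simps)
    have "s * norm y \<le> norm (A u *v y - q) + norm q"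
      using s(2)[of y] norm_triangle_ineq[of "A u *v y - q" q] by simp
    then have "(s * norm y)\<^sup>2 \<le> (norm (A u *v y - q) + norm q)\<^sup>2"
      using s(1) by (intro power_mono) auto
    also have "\<dots> \<le> 2 * (norm (A u *v y - q))\<^sup>2 + 2 * (norm q)\<^sup>2"
      using zero_le_power2[of "norm (A u *v y - q) - norm q"]
      by (simp add: power2_eq_square algebra_simps)
    finally have "lam / 4 * (s * norm y)\<^sup>2 \<le> lam / 4 * (2 * (norm (A u *v y - q))\<^sup>2 + 2 * (norm q)\<^sup>2)"
      using lam by (intro mult_left_mono) auto
    then have sq: "a * (norm y)\<^sup>2 \<le> lam / 2 * (norm (A u *v y - q))\<^sup>2 + lam / 2 * (norm q)\<^sup>2"
      by (simp add: a_def power_mult_distrib algebra_simps)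
    have "0 \<le> lam * (norm q)\<^sup>2"
      using lam by simp
    then have "a * norm y - K \<le> norm y * (a * norm y - K)"
      using ar y1 mult_right_mono[of 1 "norm y" "a * norm y - K"] by simp
    then have "lam * (norm q)\<^sup>2 \<le> a * (norm y)\<^sup>2 - K * norm y"
      using ar by (simp add: power2_eq_square algebra_simps)
    then show ?thesis
      using sq K(2)[OF y1] by (simp add: objective_def algebra_simps)
  qed
  have "continuous_on (cball 0 R) f"
    using convex_on_continuous[OF open_UNIV f] continuous_on_subset by blast
  then have "continuous_on (cball 0 R) ?\<Phi>"
    unfolding objective_def
    by (intro continuous_intros bounded_linear.continuous_on[OF matrix_vector_mul_bounded_linear])
  moreover have "R \<ge> 1"
    by (simp add: R_def)
  ultimately obtain y where y: "\<And>z. z \<in> cball 0 R \<Longrightarrow> ?\<Phi> y \<le> ?\<Phi> z"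
    using continuous_attains_inf[of "cball 0 R" ?\<Phi>] by fastforce
  have "?\<Phi> y \<le> ?\<Phi> z" for z
    using y[of z] y[of 0] far[of z] \<open>R \<ge> 1\<close> by (cases "norm z \<le> R") auto
  then show ?thesis
    by blast
qed

section \<open>Quadratic growth and continuity of the minimizer\<close>

lemma objective_quadratic_growth:
  assumes f: "convex_on UNIV f"
    and y: "\<And>z. objective f A q lam u y \<le> objective f A q lam u z"
  shows "objective f A q lam u y + lam / 4 * (norm (A u *v (z - y)))\<^sup>2 \<le> objective f A q lam u z"
proof -
  define a b where "a = A u *v y - q" and "b = A u *v z - q"
  \<comment> \<open>Minimality is tested at the midpoint, where \<open>f\<close> is at most its
    average and the squared norm falls below its average by the parallelogram defect.\<close>
  let ?m = "(1/2) *\<^sub>R y + (1/2) *\<^sub>R z"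
  have fm: "f ?m \<le> 1/2 * f y + 1/2 * f z"
    using convex_onD[OF f, of "1/2" y z] by simp
  have "A u *v ?m - q = (1/2) *\<^sub>R (a + b)"
    by (simp add: a_def b_def matrix_vector_right_distrib matrix_vector_mult_scaleR
        scaleR_right_distrib scaleR_right_diff_distrib flip: scaleR_add_left)
  moreover have "A u *v (z - y) = b - a"
    by (simp add: a_def b_def matrix_vector_mult_diff_distrib)
  \<comment> \<open>parallelogram law\<close>
  moreover have "(norm ((1/2) *\<^sub>R (a + b)))\<^sup>2 = (norm a)\<^sup>2 / 2 + (norm b)\<^sup>2 / 2 - (norm (b - a))\<^sup>2 / 4"
    by (simp add: power2_norm_eq_inner inner_add inner_diff inner_commute field_simps)
  ultimately have "objective f A q lam u ?m = f ?m
      + lam / 2 * ((norm a)\<^sup>2 / 2 + (norm b)\<^sup>2 / 2 - (norm (A u *v (z - y)))\<^sup>2 / 4)"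
    by (simp add: objective_def)
  then show ?thesis
    using y[of ?m] fm by (simp add: objective_def a_def b_def algebra_simps)
qed

text \<open>Difference of two squares, with \<open>f z\<close> cancelling. The left factor vanishes
  at \<open>u = u0\<close>, as the product rule for a vanishing left factor requires.\<close>

lemma objective_increment:
  "objective f A q lam u z - objective f A q lam u0 z
    = lam / 2 * (((A u - A u0) *v z) \<bullet> ((A u + A u0) *v z - 2 *\<^sub>R q))"
  by (simp add: objective_def power2_norm_eq_inner matrix_vector_mult_add_rdistrib
      matrix_vector_mult_diff_rdistrib inner_diff inner_add inner_commute algebra_simps)

text \<open>Growth at \<open>u0\<close> bounds the squared displacement \<open>r\<^sup>2\<close> by
  an excess of the objective, and minimality at \<open>u\<close> bounds that excess by terms of
  order \<open>e * r\<close> and \<open>e * r\<^sup>2\<close>. For small \<open>e\<close> the latter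
  is absorbed and one factor \<open>r\<close> cancels, leaving a bound linear in
  \<open>e\<close>.\<close>

lemma minimizer_continuous:
  assumes f: "convex_on UNIV f" and lam: "lam > 0" and inv: "invertible (A u0)"
    and A: "(A \<longlongrightarrow> A u0) (at u0)"
    and y: "\<And>u z. objective f A q lam u (y u) \<le> objective f A q lam u z"
  shows "(y \<longlongrightarrow> y u0) (at u0)"
proof -
  obtain s where s: "s > 0" "\<And>x. norm (A u0 *v x) \<ge> s * norm x"
    using invertible_bounded_below[OF inv] by blast
  \<comment> \<open>\<open>2 * M\<close> bounds \<open>norm (A u + A u0)\<close> once
    \<open>A u\<close> is within 1 of \<open>A u0\<close>; \<open>C\<close> collects the
    coefficients of \<open>e * r\<close> from the two Cauchy-Schwarz estimates.\<close>
  define M where "M = norm (A u0) + 1"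
  define C where "C = 4 * M * norm (y u0) + 2 * norm q"
  have M: "M > 0"
    by (simp add: M_def add_nonneg_pos)
  have E0: "((\<lambda>u. norm (A u - A u0)) \<longlongrightarrow> 0) (at u0)"
    using A by (simp add: LIM_zero tendsto_norm_zero)
  \<comment> \<open>The threshold \<open>s\<^sup>2 / (8 * M)\<close> makes the
    \<open>r\<^sup>2\<close> term on the right at most half of the one on the left.\<close>
  have "\<forall>\<^sub>F u in at u0. norm (A u - A u0) < min 1 (s\<^sup>2 / (8 * M))"
    using E0 s(1) M by (intro order_tendstoD(2)) auto
  then have "\<forall>\<^sub>F u in at u0. norm (y u - y u0) \<le> 4 * C / s\<^sup>2 * norm (A u - A u0)"
  proof (rule eventually_mono)
    fix u assume small: "norm (A u - A u0) < min 1 (s\<^sup>2 / (8 * M))"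
    define e r where "e = norm (A u - A u0)" and "r = norm (y u - y u0)"
    have eM: "2 * M * e \<le> s\<^sup>2 / 4"
      using small M by (simp add: e_def field_simps)
    have e: "e \<ge> 0" and r: "r \<ge> 0"
      by (auto simp: e_def r_def)
    have nA: "norm (A u + A u0) \<le> 2 * M"
      using norm_triangle_ineq[of "A u - A u0" "A u0 + A u0"] norm_triangle_ineq[of "A u0" "A u0"] small
      by (simp add: M_def add.commute[of "A u"])
    have S: "norm ((A u + A u0) *v x) \<le> 2 * M * norm x" for x
      using norm_matrix_vector_mult_le nA mult_right_mono norm_ge_zero order_trans by meson
    have E: "norm ((A u - A u0) *v x) \<le> e * norm x" for x
      unfolding e_def by (rule norm_matrix_vector_mult_le)
    have z: "norm (y u) \<le> norm (y u0) + r"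
      using norm_triangle_ineq[of "y u0" "y u - y u0"] by (simp add: r_def)
    let ?D = "y u - y u0"
    let ?w = "\<lambda>z. (A u + A u0) *v z - 2 *\<^sub>R q"
    have w: "norm (?w (y u)) \<le> 2 * M * (norm (y u0) + r) + 2 * norm q"
    proof -
      have "norm (?w (y u)) \<le> 2 * M * norm (y u) + 2 * norm q"
        using norm_triangle_ineq4[of "(A u + A u0) *v y u" "2 *\<^sub>R q"] S[of "y u"] by simp
      also have "\<dots> \<le> 2 * M * (norm (y u0) + r) + 2 * norm q"
        using z M by simp
      finally show ?thesis .
    qed
    have t1: "((A u - A u0) *v ?D) \<bullet> ?w (y u) \<ge> - (e * r * (2 * M * (norm (y u0) + r) + 2 * norm q))"
    proof -
      have "\<bar>((A u - A u0) *v ?D) \<bullet> ?w (y u)\<bar> \<le> norm ((A u - A u0) *v ?D) * norm (?w (y u))"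
        by (rule Cauchy_Schwarz_ineq2)
      also have "\<dots> \<le> (e * r) * (2 * M * (norm (y u0) + r) + 2 * norm q)"
        using E[of ?D] w e r by (intro mult_mono) (auto simp: r_def)
      finally show ?thesis by linarith
    qed
    have t2: "((A u - A u0) *v y u0) \<bullet> ((A u + A u0) *v ?D) \<ge> - (e * norm (y u0) * (2 * M * r))"
    proof -
      have "\<bar>((A u - A u0) *v y u0) \<bullet> ((A u + A u0) *v ?D)\<bar>
          \<le> norm ((A u - A u0) *v y u0) * norm ((A u + A u0) *v ?D)"
        by (rule Cauchy_Schwarz_ineq2)
      also have "\<dots> \<le> (e * norm (y u0)) * (2 * M * r)"
        using E[of "y u0"] S[of ?D] e by (intro mult_mono) (auto simp: r_def)
      finally show ?thesis by linarith
    qed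
    \<comment> \<open>Changing one factor of the inner product at a time leaves both
      \<open>A u - A u0\<close> and the displacement in each summand.\<close>
    have split: "((A u - A u0) *v y u) \<bullet> ?w (y u) - ((A u - A u0) *v y u0) \<bullet> ?w (y u0)
        = ((A u - A u0) *v ?D) \<bullet> ?w (y u) + ((A u - A u0) *v y u0) \<bullet> ((A u + A u0) *v ?D)"
      by (simp add: matrix_vector_mult_diff_distrib inner_diff_left inner_diff_right)
    have "lam / 4 * (s * r)\<^sup>2 \<le> lam / 4 * (norm (A u0 *v ?D))\<^sup>2"
      using s r lam by (intro mult_left_mono power_mono) (auto simp: r_def)
    also have "\<dots> \<le> objective f A q lam u0 (y u) - objective f A q lam u0 (y u0)"
      using objective_quadratic_growth[OF f y, of u0 "y u"] by simp
    \<comment> \<open>Adds the nonnegative gap between the objective at \<open>y u0\<close> and at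
      its minimizer \<open>y u\<close> for the parameter \<open>u\<close>.\<close>
    also have "\<dots> \<le> (objective f A q lam u (y u0) - objective f A q lam u0 (y u0))
        - (objective f A q lam u (y u) - objective f A q lam u0 (y u))"
      using y[of u "y u0"] by simp
    also have "\<dots> = lam / 2 * - (((A u - A u0) *v y u) \<bullet> ?w (y u) - ((A u - A u0) *v y u0) \<bullet> ?w (y u0))"
      unfolding objective_increment by (simp add: algebra_simps)
    also have "\<dots> \<le> lam / 2 * (e * r * (2 * M * (norm (y u0) + r) + 2 * norm q) + e * norm (y u0) * (2 * M * r))"
      using t1 t2 lam unfolding split by (intro mult_left_mono) auto
    also have "\<dots> = lam / 2 * (r * (e * C + (2 * M * e) * r))"
      by (simp add: C_def algebra_simps)
    also have "\<dots> \<le> lam / 2 * (r * (e * C + s\<^sup>2 / 4 * r))"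
      using eM r lam by (intro mult_left_mono add_left_mono mult_right_mono) auto
    finally have "lam * (r * (s\<^sup>2 / 4 * r)) \<le> lam * (r * (e * C) / 2 + r * (s\<^sup>2 / 4 * r) / 2)"
      by (simp add: power2_eq_square algebra_simps)
    then have "r * (s\<^sup>2 / 4 * r) \<le> r * (e * C) / 2 + r * (s\<^sup>2 / 4 * r) / 2"
      using lam by (simp only: mult_le_cancel_left_pos)
    then have "r * (s\<^sup>2 / 4 * r) \<le> r * (e * C)"
      by linarith
    \<comment> \<open>Covers the case \<open>r = 0\<close>, where \<open>r\<close> cannot be
      cancelled.\<close>
    moreover have "0 \<le> e * C"
      using e M by (simp add: C_def)
    ultimately have "s\<^sup>2 / 4 * r \<le> e * C"
      using r by (cases "r = 0") (simp_all add: mult_le_cancel_left_pos)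
    then show "r \<le> 4 * C / s\<^sup>2 * e"
      using s(1) by (simp add: field_simps)
  qed
  then have "((\<lambda>u. y u - y u0) \<longlongrightarrow> 0) (at u0)"
    by (rule Lim_null_comparison) (rule tendsto_mult_right_zero[OF E0])
  then show ?thesis
    by (rule LIM_zero_cancel)
qed

text \<open>Envelope theorem: freezing \<open>y u0\<close> bounds the reduced function from above;
  adding to its value at \<open>u0\<close> the increment taken at \<open>y u\<close> bounds it from
  below. Both bounds have the derivative \<open>L\<close>.\<close>

lemma reduced_fun_differentiable:
  assumes f: "convex_on UNIV f" and lam: "lam > 0" and inv: "\<And>u. invertible (A u)"
    and A: "A differentiable (at u0)"
  shows "reduced_fun f A q lam differentiable (at u0)"
proof -
  let ?\<Phi> = "objective f A q lam"
  obtain y where y: "\<And>u z. ?\<Phi> u (y u) \<le> ?\<Phi> u z"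
    using objective_attains_min[where q=q and A=A, OF f lam inv] by metis
  have red: "reduced_fun f A q lam u = ?\<Phi> u (y u)" for u
    unfolding reduced_fun_def by (rule Least_equality) (use y in auto)
  obtain A' where A': "(A has_derivative A') (at u0)"
    using A unfolding differentiable_def by blast
  then have Alim: "(A \<longlongrightarrow> A u0) (at u0)"
    using differentiable_imp_continuous_within[OF A] by (simp add: continuous_within)
  have ylim: "(y \<longlongrightarrow> y u0) (at u0)"
    using minimizer_continuous[OF f lam inv Alim y] .
  \<comment> \<open>The partial derivative of the objective in the parameter, with
    \<open>y u0\<close> held fixed.\<close>
  define L where "L h = lam / 2 * ((A' h *v y u0) \<bullet> ((A u0 + A u0) *v y u0 - 2 *\<^sub>R q))" for h
  have incr: "((\<lambda>u. ?\<Phi> u0 (y u0) + (?\<Phi> u (z u) - ?\<Phi> u0 (z u))) has_derivative L) (at u0)"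
    if z: "(z \<longlongrightarrow> z u0) (at u0)" "z u0 = y u0" for z
  proof -
    \<comment> \<open>The rule for a vanishing left factor is used twice: for the matrix-vector
      product, then for the inner product.\<close>
    have "((\<lambda>u. A u - A u0) has_derivative A') (at u0)"
      using A' by (auto intro!: derivative_eq_intros)
    then have "((\<lambda>u. (A u - A u0) *v z u) has_derivative (\<lambda>h. A' h *v z u0)) (at u0)"
      using z(1) by (intro bounded_bilinear.has_derivative_vanishing_left
          [OF bounded_bilinear_matrix_vector_mult]) auto
    moreover have "((\<lambda>u. (A u + A u0) *v z u - 2 *\<^sub>R q)
        \<longlongrightarrow> (A u0 + A u0) *v z u0 - 2 *\<^sub>R q) (at u0)"
      by (intro tendsto_intros Alim z(1)
          bounded_bilinear.tendsto[OF bounded_bilinear_matrix_vector_mult])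
    ultimately have "((\<lambda>u. ((A u - A u0) *v z u) \<bullet> ((A u + A u0) *v z u - 2 *\<^sub>R q))
        has_derivative (\<lambda>h. (A' h *v z u0) \<bullet> ((A u0 + A u0) *v z u0 - 2 *\<^sub>R q))) (at u0)"
      by (intro bounded_bilinear.has_derivative_vanishing_left[OF bounded_bilinear_inner,
            where w = "\<lambda>u. (A u + A u0) *v z u - 2 *\<^sub>R q"]) auto
    from has_derivative_add[OF has_derivative_const has_derivative_mult_right[OF this]]
    show ?thesis
      unfolding objective_increment L_def z(2) add_0 .
  qed
  have "(reduced_fun f A q lam has_derivative L) (at u0)"
    by (rule has_derivative_sandwich[OF incr[of "\<lambda>_. y u0"] incr[OF ylim]])
      (use y in \<open>auto simp: red\<close>)
  then show ?thesis
    unfolding differentiable_def by blast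
qed

section \<open>Inexact gradient descent\<close>

text \<open>With step \<open>1 / \<beta>\<close>, the descent lemma leaves
  \<open>(norm v)\<^sup>2 - 2 * (?G \<bullet> v)\<close>, which equals
  \<open>(norm (v - ?G))\<^sup>2 - (norm ?G)\<^sup>2\<close>.\<close>

lemma inexact_gradient_step:
  fixes F :: "'a::euclidean_space \<Rightarrow> real"
  assumes diff: "\<And>x. F differentiable (at x)"
    and lip: "\<beta>-lipschitz_on UNIV (gradient F)" and \<beta>: "\<beta> > 0"
  shows "(norm (gradient F x))\<^sup>2
    \<le> 2 * \<beta> * (F x - F (x - (1 / \<beta>) *\<^sub>R v)) + (norm (v - gradient F x))\<^sup>2"
proof -
  let ?G = "gradient F x"
  have "F (x - (1 / \<beta>) *\<^sub>R v) \<le> F x - (?G \<bullet> v) / \<beta> + (norm v)\<^sup>2 / (2 * \<beta>)"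
    using descent_lemma[OF diff lip, of "x - (1 / \<beta>) *\<^sub>R v" x] \<beta>
    by (simp add: power2_eq_square field_simps)
  then have "2 * \<beta> * F (x - (1 / \<beta>) *\<^sub>R v) \<le> 2 * \<beta> * (F x - (?G \<bullet> v) / \<beta> + (norm v)\<^sup>2 / (2 * \<beta>))"
    using \<beta> by (intro mult_left_mono) auto
  also have "\<dots> = 2 * \<beta> * F x - 2 * (?G \<bullet> v) + (norm v)\<^sup>2"
    using \<beta> by (simp add: field_simps)
  finally show ?thesis
    by (simp add: power2_norm_eq_inner inner_diff inner_commute algebra_simps)
qed

lemma sum_inverse_squares_le: "(\<Sum>i=1..k. 1 / (real i)\<^sup>2) \<le> pi\<^sup>2 / 6"
proof -
  have basel: "(\<lambda>n. 1 / (real n + 1)\<^sup>2) sums (pi\<^sup>2 / 6)"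
    using inverse_squares_sums by (simp add: add.commute)
  have "(\<Sum>i=1..k. 1 / (real i)\<^sup>2) = (\<Sum>n<k. 1 / (real n + 1)\<^sup>2)"
    by (rule sum.reindex_bij_witness[of _ Suc "\<lambda>i. i - 1"]) auto
  also have "\<dots> \<le> (\<Sum>n. 1 / (real n + 1)\<^sup>2)"
    by (intro sum_le_suminf sums_summable[OF basel]) auto
  also have "\<dots> = pi\<^sup>2 / 6"
    using basel by (simp add: sums_iff)
  finally show ?thesis .
qed

theorem mainTheorem2:
  fixes q :: "real^'n"
    and f :: "real^'n \<Rightarrow> real"
    and A :: "real^'d \<Rightarrow> real^'n^'n"
    and g H :: "real^'d \<Rightarrow> real"
    and lam \<beta> c :: real
    and u v :: "nat \<Rightarrow> real^'d"
  assumes "convex_on UNIV f"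
    and "C_k 2 f"
    and "C_k 2 A"
    and "\<And>x. invertible (A x)"
    and "C_k 1 g"
    and "lam > 0"
    and H: "H = (\<lambda>x. g x + reduced_fun f A q lam x)"
    and "\<beta> > 0"
    and "\<beta>-lipschitz_on UNIV (gradient H)"
    and "bdd_below (range H)"
    and "c > 0"
    and "\<And>k. k \<ge> 1 \<Longrightarrow> u (Suc k) = u k - (1 / \<beta>) *\<^sub>R v k"
    and "\<And>k. k \<ge> 1 \<Longrightarrow> norm (v k - gradient H (u k)) \<le> c / real k"
  shows "\<forall>k\<ge>1.
      (MIN i\<in>{1..k}. (norm (gradient H (u i)))\<^sup>2)
        \<le> 1 / real k * (\<Sum>i=1..k. (norm (gradient H (u i)))\<^sup>2)
    \<and> 1 / real k * (\<Sum>i=1..k. (norm (gradient H (u i)))\<^sup>2)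
        \<le> 2 * \<beta> * (H (u 1) - (INF x. H x)) / real k
          + 1 / real k * (\<Sum>i=1..k. (norm (v i - gradient H (u i)))\<^sup>2)
    \<and> 2 * \<beta> * (H (u 1) - (INF x. H x)) / real k
          + 1 / real k * (\<Sum>i=1..k. (norm (v i - gradient H (u i)))\<^sup>2)
        \<le> 2 * \<beta> * (H (u 1) - (INF x. H x)) / real k + c\<^sup>2 * pi\<^sup>2 / (6 * real k)
    \<and> (\<forall>ustar. is_arg_min H (\<lambda>_. True) ustar \<longrightarrow>
          2 * \<beta> * (H (u 1) - (INF x. H x)) / real k + c\<^sup>2 * pi\<^sup>2 / (6 * real k)
            \<le> (\<beta>\<^sup>2 * (norm (u 1 - ustar))\<^sup>2 + c\<^sup>2 * pi\<^sup>2 / 6) / real k)"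
proof (intro allI impI conjI)
  have diff: "H differentiable (at x)" for x
  proof -
    have "A differentiable (at x)" "g differentiable (at x)"
      using assms(3,5) by (auto simp: numeral_2_eq_2)
    then show ?thesis
      unfolding H using assms(1,4,6) by (intro differentiable_add reduced_fun_differentiable)
  qed
  have inf_le: "(INF x. H x) \<le> H x" for x
    using assms(10) by (intro cINF_lower) auto
  fix k :: nat assume k: "k \<ge> 1"
  let ?G = "\<lambda>i. (norm (gradient H (u i)))\<^sup>2"
  let ?e = "\<lambda>i. (norm (v i - gradient H (u i)))\<^sup>2"
  have "real k * (MIN i\<in>{1..k}. ?G i) = (\<Sum>i=1..k. MIN i\<in>{1..k}. ?G i)"
    by simp
  also have "\<dots> \<le> (\<Sum>i=1..k. ?G i)"
    by (intro sum_mono Min_le) auto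
  finally show "(MIN i\<in>{1..k}. ?G i) \<le> 1 / real k * (\<Sum>i=1..k. ?G i)"
    using k by (simp add: field_simps)
  have "(\<Sum>i=1..k. ?G i) \<le> (\<Sum>i=1..k. 2 * \<beta> * (H (u i) - H (u (Suc i))) + ?e i)"
    using inexact_gradient_step[OF diff assms(9,8)] assms(12) by (intro sum_mono) auto
  also have "\<dots> = 2 * \<beta> * (\<Sum>i=1..k. H (u i) - H (u (Suc i))) + (\<Sum>i=1..k. ?e i)"
    by (simp add: sum.distrib sum_distrib_left)
  also have "(\<Sum>i=1..k. H (u i) - H (u (Suc i))) = H (u 1) - H (u (Suc k))"
    using sum_Suc_diff[of 1 k "\<lambda>i. - H (u i)"] by simp
  \<comment> \<open>After telescoping, only the last value remains, and the infimum bounds it from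
    below.\<close>
  also have "2 * \<beta> * (H (u 1) - H (u (Suc k))) \<le> 2 * \<beta> * (H (u 1) - (INF x. H x))"
    using inf_le assms(8) by (intro mult_left_mono) auto
  finally show "1 / real k * (\<Sum>i=1..k. ?G i)
      \<le> 2 * \<beta> * (H (u 1) - (INF x. H x)) / real k + 1 / real k * (\<Sum>i=1..k. ?e i)"
    using k by (simp add: field_simps)
  have "(\<Sum>i=1..k. ?e i) \<le> (\<Sum>i=1..k. (c / real i)\<^sup>2)"
    using assms(13) by (intro sum_mono power_mono) auto
  also have "\<dots> = c\<^sup>2 * (\<Sum>i=1..k. 1 / (real i)\<^sup>2)"
    by (simp add: sum_distrib_left power_divide)
  also have "\<dots> \<le> c\<^sup>2 * (pi\<^sup>2 / 6)"
    by (intro mult_left_mono sum_inverse_squares_le) auto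
  finally show "2 * \<beta> * (H (u 1) - (INF x. H x)) / real k + 1 / real k * (\<Sum>i=1..k. ?e i)
      \<le> 2 * \<beta> * (H (u 1) - (INF x. H x)) / real k + c\<^sup>2 * pi\<^sup>2 / (6 * real k)"
    using k by (simp add: field_simps)
  fix ustar assume "is_arg_min H (\<lambda>_. True) ustar"
  then have min: "H ustar \<le> H x" for x
    by (auto simp: is_arg_min_def not_less)
  then have "(INF x. H x) = H ustar"
    using inf_le[of ustar] by (intro antisym cINF_greatest) auto
  \<comment> \<open>The descent lemma is expanded around \<open>ustar\<close>, where the linear term
    vanishes.\<close>
  moreover have "H (u 1) \<le> H ustar + \<beta> / 2 * (norm (u 1 - ustar))\<^sup>2"
    using descent_lemma[OF diff assms(9), of "u 1" ustar] gradient_zero_at_min[OF diff min] by simp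
  then have "2 * \<beta> * (H (u 1) - H ustar) \<le> 2 * \<beta> * (\<beta> / 2 * (norm (u 1 - ustar))\<^sup>2)"
    using assms(8) by (intro mult_left_mono) auto
  ultimately have "2 * \<beta> * (H (u 1) - (INF x. H x)) / real k \<le> \<beta>\<^sup>2 * (norm (u 1 - ustar))\<^sup>2 / real k"
    by (intro divide_right_mono) (auto simp: power2_eq_square)
  then show "2 * \<beta> * (H (u 1) - (INF x. H x)) / real k + c\<^sup>2 * pi\<^sup>2 / (6 * real k)
      \<le> (\<beta>\<^sup>2 * (norm (u 1 - ustar))\<^sup>2 + c\<^sup>2 * pi\<^sup>2 / 6) / real k"
    by (simp add: add_divide_distrib)
qed

end
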